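(* Let $X=\{a_1,\dots,a_n\}$, let $\mathcal{F}$ be a union-closed family of subsets of $X$ with $\bigcup_{f\in\mathcal{F}}f=X$, let $w=a_1\cdots a_n$, and let $S\subseteq\mathcal{F}$ be an antichain. Then $$\frac{1}{|\mathcal{F}[S]|}\sum_{f\in\mathcal{F}[S]}|f|\ \ge\ \frac{n}{2}+\frac{1}{2|\mathcal{F}[S]|}\sum_{a\in X}|\pi_w(a)\cap S^{\uparrow}|-\frac12\log_2\!\left(\frac{|S^{\uparrow}|}{|\mathcal{F}[S]|}\right),$$ and equality holds when $\mathcal{F}$ is upward-closed and $S=\min(\mathcal{F})$.
   Context: Union-closed: $f,g\in\mathcal{F}\Rightarrow f\cup g\in\mathcal{F}$. Upward-closed: $f\in\mathcal{F}$, $f\subseteq g\subseteq X$ imply $g\in\mathcal{F}$. An antichain is a non-empty family of pairwise incomparable sets; $\min(\mathcal{F})$ is the set of inclusion-minimal members. $\mathcal{F}[S]=\{f\in\mathcal{F}:\exists z\in S,\ z\subseteq f\}$ and $S^{\uparrow}=\{g\subseteq X:\exists z\in S,\ z\subseteq g\}$. For a family $\mathcal{H}$ and $a\in X$, $\mathcal{H}_a=\{h\in\mathcal{H}:a\in h\}$. Rising functions: for $T\subseteq 2^X$ and $a\in X$, $\varphi_{T,a}(z)=z\cup\{a\}$ if $z\cup\{a\}\notin T$ and $\varphi_{T,a}(z)=z$ otherwise ($z\in T$); for the word $w=a_1\cdots a_n$, put $\varphi_0=\mathrm{id}$, $\mathcal{F}_0=\mathcal{F}$, $\varphi_j=\varphi_{\mathcal{F}_{j-1},a_j}\circ\varphi_{j-1}$,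 $\mathcal{F}_j=\varphi_j(\mathcal{F})$, and $\varphi_w=\varphi_n$ (injective on $\mathcal{F}$). The set of pure elements with respect to $a$ is $\pi_w(a)=\{\eta\in\varphi_w(\mathcal{F}_a):\eta\setminus\{a\}\notin\varphi_w(\mathcal{F})\}$. *)

theory Defs
  imports Complex_Main
begin

definition union_closed :: "'a set set \<Rightarrow> bool" where
  "union_closed F \<longleftrightarrow> (\<forall>f\<in>F. \<forall>g\<in>F. f \<union> g \<in> F)"

definition upward_closed :: "'a set \<Rightarrow> 'a set set \<Rightarrow> bool" where
  "upward_closed X F \<longleftrightarrow> (\<forall>f\<in>F. \<forall>g. f \<subseteq> g \<and> g \<subseteq> X \<longrightarrow> g \<in> F)"

definition antichain :: "'a set set \<Rightarrow> bool" where
  "antichain S \<longleftrightarrow>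
     S \<noteq> {} \<and> (\<forall>f\<in>S. \<forall>g\<in>S. f \<noteq> g \<longrightarrow> \<not> f \<subseteq> g \<and> \<not> g \<subseteq> f)"

definition min_members :: "'a set set \<Rightarrow> 'a set set" where
  "min_members F = {f \<in> F. \<not> (\<exists>g\<in>F. g \<subset> f)}"

(* F[S] *)
definition members_above :: "'a set set \<Rightarrow> 'a set set \<Rightarrow> 'a set set" where
  "members_above F S = {f \<in> F. \<exists>z\<in>S. z \<subseteq> f}"

(* The up-set generated by S in the power set of X. *)
definition up_set :: "'a set \<Rightarrow> 'a set set \<Rightarrow> 'a set set" where
  "up_set X S = {g. g \<subseteq> X \<and> (\<exists>z\<in>S. z \<subseteq> g)}"

(* H_a *)
definition members_with :: "'a set set \<Rightarrow> 'a \<Rightarrow> 'a set set" where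
  "members_with H a = {h \<in> H. a \<in> h}"

(* The rising function of T and a; only its values on members of T matter. *)
definition rising :: "'a set set \<Rightarrow> 'a \<Rightarrow> 'a set \<Rightarrow> 'a set" where
  "rising T a z = (if z \<union> {a} \<notin> T then z \<union> {a} else z)"

(* rising_upto F w j composes the rising functions of the first j letters of w, each
   relative to the image of F under the preceding ones.  The (j+1)-st letter is w ! j.
   Meaningful for j <= length w. *)
primrec rising_upto :: "'a set set \<Rightarrow> 'a list \<Rightarrow> nat \<Rightarrow> 'a set \<Rightarrow> 'a set" where
  "rising_upto F w 0 = id"
| "rising_upto F w (Suc j) = rising (rising_upto F w j ` F) (w ! j) \<circ> rising_upto F w j"

definition rising_word :: "'a set set \<Rightarrow> 'a list \<Rightarrow> 'a set \<Rightarrow> 'a set" where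
  "rising_word F w = rising_upto F w (length w)"

definition pure_elements :: "'a set set \<Rightarrow> 'a list \<Rightarrow> 'a \<Rightarrow> 'a set set" where
  "pure_elements F w a =
     {\<eta> \<in> rising_word F w ` members_with F a. \<eta> - {a} \<notin> rising_word F w ` F}"

end

theory Submission
  imports Defs
begin

text \<open>
  Reimer's argument, localised above \<open>S\<close>. Write \<open>\<phi>\<close> for the rising map of \<open>w\<close>. Its image is an
  up-set, and no member of \<open>F\<close> other than \<open>f\<close> lies in the interval \<open>[f, \<phi> f]\<close>; hence, \<open>F\<close> being
  union-closed, these intervals are pairwise disjoint. Those with \<open>f \<in> F[S]\<close> lie in the up-set of
  \<open>S\<close>, so \<open>\<Sum> 2^|\<phi> f - f|\<close> is at most its size, and Jensen's inequality bounds \<open>\<Sum> |\<phi> f - f|\<close>.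
  On the other hand, for each letter \<open>a\<close>, the members of \<open>F[S]\<close> containing \<open>a\<close> are at least as many
  as the \<open>f \<in> F[S]\<close> with \<open>a \<notin> \<phi> f\<close> (send \<open>f\<close> to the preimage of \<open>\<phi> f \<union> {a}\<close>) together with the
  pure elements above \<open>S\<close>. Summing over \<open>a\<close> bounds \<open>\<Sum> (|f| + |\<phi> f|)\<close> from below, and the two
  estimates combine via \<open>2 |f| = |f| + |\<phi> f| - |\<phi> f - f|\<close>.
\<close>

section \<open>One rising step\<close>

lemma subset_rising: "z \<subseteq> rising T a z"
  by (auto simp: rising_def)

lemma rising_subset: "rising T a z \<subseteq> insert a z"
  by (auto simp: rising_def)

text \<open>A moved set lands outside \<open>T\<close>, so it cannot collide with a fixed one; two
  moved sets both lack \<open>a\<close>, so inserting \<open>a\<close> does not merge them.\<close>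

lemma inj_on_rising: "inj_on (rising T a) T"
proof (rule inj_onI)
  fix x y assume "x \<in> T" "y \<in> T" "rising T a x = rising T a y"
  then show "x = y"
    by (cases "a \<in> x"; cases "a \<in> y")
      (auto simp: rising_def insert_absorb insert_ident split: if_splits)
qed

text \<open>The image can be read off on each pair \<open>{y - {a}, insert a y}\<close> separately:
  the upper set is present if either was in \<open>T\<close>, the lower one only if both were. The
  closure properties below become case checks on this criterion, without mention of the map
  itself.\<close>

lemma mem_rising_image_iff:
  "y \<in> rising T a ` T \<longleftrightarrow> (if a \<in> y then y \<in> T \<or> y - {a} \<in> T else y \<in> T \<and> insert a y \<in> T)"
proof
  assume "y \<in> rising T a ` T"
  then obtain z where "z \<in> T" "y = rising T a z" by (rule imageE)
  then show "if a \<in> y then y \<in> T \<or> y - {a} \<in> T else y \<in> T \<and> insert a y \<in> T"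
    by (cases "a \<in> z") (simp_all add: rising_def insert_absorb)
next
  assume *: "if a \<in> y then y \<in> T \<or> y - {a} \<in> T else y \<in> T \<and> insert a y \<in> T"
  show "y \<in> rising T a ` T"
  proof (cases "y \<in> T")
    case True
    then have "y = rising T a y" using * by (simp add: rising_def insert_absorb split: if_splits)
    then show ?thesis using True by (rule image_eqI)
  next
    case False
    then have "y - {a} \<in> T" "a \<in> y" using * by (simp_all split: if_splits)
    moreover from this have "y = rising T a (y - {a})"
      using False by (simp add: rising_def insert_absorb)
    ultimately show ?thesis by (intro image_eqI)
  qed
qed

lemma union_closed_rising_image:
  assumes "union_closed T"
  shows "union_closed (rising T a ` T)"
  unfolding union_closed_def
proof (intro ballI)
  fix x y
  assume x: "x \<in> rising T a ` T" and y: "y \<in> rising T a ` T"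
  have U: "\<And>p q. p \<in> T \<Longrightarrow> q \<in> T \<Longrightarrow> p \<union> q \<in> T"
    using assms by (auto simp: union_closed_def)
  show "x \<union> y \<in> rising T a ` T"
  proof (cases "a \<in> x \<union> y")
    case False
    \<comment> \<open>Here the criterion puts \<open>x\<close>, \<open>y\<close> and also
      \<open>insert a x\<close>, \<open>insert a y\<close> in \<open>T\<close>, and both pairs are
      closed under union.\<close>
    then show ?thesis
      using x y U[of x y] U[of "insert a x" "insert a y"]
      by (simp add: mem_rising_image_iff)
  next
    case True
    \<comment> \<open>It suffices to find \<open>x \<union> y\<close> in \<open>T\<close> up to the
      letter \<open>a\<close>, so representatives that are correct up to \<open>a\<close> are
      enough.\<close>
    obtain x' where x': "x' \<in> T" "x' = x \<or> x' = x - {a}"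
      using x unfolding mem_rising_image_iff by metis
    obtain y' where y': "y' \<in> T" "y' = y \<or> y' = y - {a}"
      using y unfolding mem_rising_image_iff by metis
    have "x' \<union> y' \<in> T" using U x'(1) y'(1) .
    moreover have "x' \<union> y' = x \<union> y \<or> x' \<union> y' = x \<union> y - {a}"
      using x'(2) y'(2) True by auto
    ultimately have "x \<union> y \<in> T \<or> x \<union> y - {a} \<in> T" by metis
    then show ?thesis using True by (simp only: mem_rising_image_iff if_True)
  qed
qed

text \<open>Inserting \<open>b\<close> commutes with removing or inserting a different letter
  \<open>a\<close>, so it respects the pairs on which the step acts. Closure gained at one letter
  therefore survives all later letters.\<close>

lemma insert_closed_rising_image:
  assumes "\<forall>y\<in>T. insert b y \<in> T"
  shows "\<forall>y\<in>rising T a ` T. insert b y \<in> rising T a ` T"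
proof
  fix y assume y: "y \<in> rising T a ` T"
  show "insert b y \<in> rising T a ` T"
  proof (cases "b = a")
    case True
    then show ?thesis using y assms
      by (auto simp: mem_rising_image_iff insert_absorb split: if_splits)
  next
    case False
    then have "insert b y - {a} = insert b (y - {a})" by auto
    then show ?thesis using y assms False
      by (auto simp: mem_rising_image_iff insert_commute split: if_splits)
  qed
qed

lemma rising_image_insert_closed: "\<forall>y\<in>rising T a ` T. insert a y \<in> rising T a ` T"
proof
  fix y assume "y \<in> rising T a ` T"
  then show "insert a y \<in> rising T a ` T"
    by (cases "a \<in> y") (simp_all add: mem_rising_image_iff insert_absorb)
qed

text \<open>The induction step for keeping intervals free of other members: a strictly larger set
  \<open>u\<close> cannot disappear from above \<open>f\<close>. The bound is
  \<open>u \<union> rising T a f\<close> rather than \<open>u\<close>, because \<open>f\<close> may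
  have gained \<open>a\<close> while \<open>u\<close> lacks it.\<close>

lemma rising_image_between:
  assumes T: "union_closed T" and f: "f \<in> T" and u: "u \<in> T" and fu: "f \<subset> u"
  shows "\<exists>v\<in>rising T a ` T. rising T a f \<subset> v \<and> v \<subseteq> u \<union> rising T a f"
proof (cases "insert a f \<in> T")
  case True
  \<comment> \<open>If \<open>f\<close> is blocked by \<open>insert a f\<close>, union-closure
    yields \<open>insert a u\<close>, which blocks \<open>u\<close> as well; so \<open>u\<close>
    itself serves as witness.\<close>
  then have "insert a f \<union> u \<in> T" using T u by (auto simp: union_closed_def)
  moreover have "insert a f \<union> u = insert a u" using fu by auto
  ultimately have "u \<in> rising T a ` T"
    using u by (auto simp: mem_rising_image_iff)
  moreover have "rising T a f = f" using True by (simp add: rising_def)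
  ultimately show ?thesis using fu by auto
next
  case False
  then have r: "rising T a f = insert a f" by (simp add: rising_def)
  have "insert a u \<in> rising T a ` T"
    using u by (cases "a \<in> u") (auto simp: mem_rising_image_iff insert_absorb)
  moreover have "insert a f \<subset> insert a u"
  proof -
    \<comment> \<open>Strictness could only fail if \<open>f\<close> and \<open>u\<close> differed
      in \<open>a\<close> alone, but then \<open>u\<close> would have blocked
      \<open>f\<close>.\<close>
    have "insert a f \<noteq> u" using False u by auto
    moreover have "a \<notin> f" using False f by (auto simp: insert_absorb)
    ultimately show ?thesis using fu by auto
  qed
  ultimately show ?thesis unfolding r by (intro bexI[of _ "insert a u"]) (simp_all, blast)
qed

section \<open>Rising along a prefix of the word\<close>

lemma rising_upto_Suc_image:
  "rising_upto F w (Suc j) ` F = rising (rising_upto F w j ` F) (w ! j) ` (rising_upto F w j ` F)"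
  by (simp add: image_comp)

lemma subset_rising_upto: "f \<subseteq> rising_upto F w j f"
proof (induction j)
  case (Suc j)
  then show ?case using subset_trans subset_rising by fastforce
qed simp

lemma rising_upto_subset:
  "j \<le> length w \<Longrightarrow> rising_upto F w j f \<subseteq> f \<union> set w"
proof (induction j)
  case (Suc j)
  then show ?case
    using rising_subset[of "rising_upto F w j ` F" "w ! j" "rising_upto F w j f"] nth_mem[of j w]
    by auto
qed simp

lemma inj_on_rising_upto: "inj_on (rising_upto F w j) F"
proof (induction j)
  case (Suc j)
  then show ?case
    unfolding rising_upto.simps by (rule comp_inj_on) (rule inj_on_rising)
qed simp

lemma union_closed_rising_upto:
  "union_closed F \<Longrightarrow> union_closed (rising_upto F w j ` F)"
  by (induction j) (simp_all only: rising_upto_Suc_image union_closed_rising_image, simp)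

text \<open>Closure under the letter \<open>w ! i\<close> is created by the step that processes it
  and preserved by every later one.\<close>

lemma rising_upto_insert_closed:
  "i < j \<Longrightarrow> y \<in> rising_upto F w j ` F \<Longrightarrow> insert (w ! i) y \<in> rising_upto F w j ` F"
proof (induction j arbitrary: y)
  case (Suc j)
  show ?case
  proof (cases "i = j")
    case True
    then show ?thesis
      using Suc.prems(2) bspec[OF rising_image_insert_closed]
      unfolding rising_upto_Suc_image by simp
  next
    case False
    then have "\<forall>y\<in>rising_upto F w j ` F. insert (w ! i) y \<in> rising_upto F w j ` F"
      using Suc by auto
    then show ?thesis
      using Suc.prems(2) unfolding rising_upto_Suc_image
      by (intro bspec[OF insert_closed_rising_image])
  qed
qed simp

text \<open>Serves for a contradiction: if \<open>u\<close> also lay inside the risen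
  \<open>f\<close>, then \<open>v\<close> would be a subset of that set and strictly contain
  it.\<close>

lemma rising_upto_between:
  assumes "union_closed F" "f \<in> F" "u \<in> F" "f \<subset> u"
  shows "\<exists>v\<in>rising_upto F w j ` F. rising_upto F w j f \<subset> v \<and> v \<subseteq> u \<union> rising_upto F w j f"
proof (induction j)
  case 0
  then show ?case using assms by auto
next
  case (Suc j)
  let ?T = "rising_upto F w j ` F" and ?f = "rising_upto F w j f"
  obtain v where v: "v \<in> ?T" "?f \<subset> v" "v \<subseteq> u \<union> ?f"
    using Suc by metis
  have "?f \<in> ?T" using assms(2) by (rule imageI)
  from rising_image_between[OF union_closed_rising_upto[OF assms(1)] this v(1,2), of "w ! j"]
  obtain v' where v': "v' \<in> rising ?T (w ! j) ` ?T" "rising ?T (w ! j) ?f \<subset> v'"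
      "v' \<subseteq> v \<union> rising ?T (w ! j) ?f"
    by metis
  moreover have "v' \<subseteq> u \<union> rising ?T (w ! j) ?f"
    using v'(3) v(3) subset_rising[of ?f ?T "w ! j"] by blast
  ultimately show ?case
    unfolding rising_upto_Suc_image by (intro bexI[of _ v']) simp_all
qed

section \<open>The whole word: intervals from a set to its image\<close>

lemma subset_rising_word: "f \<subseteq> rising_word F w f"
  by (simp add: rising_word_def subset_rising_upto)

lemma rising_word_subset: "rising_word F w f \<subseteq> f \<union> set w"
  by (simp add: rising_word_def rising_upto_subset)

lemma inj_on_rising_word: "inj_on (rising_word F w) F"
  by (simp add: rising_word_def inj_on_rising_upto)

lemma rising_word_image_insert_closed:
  assumes "a \<in> set w" "y \<in> rising_word F w ` F"
  shows "insert a y \<in> rising_word F w ` F"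
proof -
  obtain i where "i < length w" "w ! i = a" using assms(1) by (auto simp: in_set_conv_nth)
  then show ?thesis
    using assms(2) rising_upto_insert_closed unfolding rising_word_def by blast
qed

lemma only_member_between_rising_word:
  assumes "union_closed F" "f \<in> F" "u \<in> F" "f \<subseteq> u" "u \<subseteq> rising_word F w f"
  shows "u = f"
proof (rule ccontr)
  assume "u \<noteq> f"
  then have "f \<subset> u" using assms(4) by auto
  from rising_upto_between[OF assms(1-3) this, of w "length w"]
  obtain v where "rising_word F w f \<subset> v" "v \<subseteq> u \<union> rising_word F w f"
    unfolding rising_word_def by blast
  then show False using assms(5) by auto
qed

text \<open>The two inclusions say exactly that the intervals of \<open>f\<close> and
  \<open>g\<close> meet, since \<open>f \<union> g\<close> then lies in both. By union-closure it is
  a member, hence equal to each bottom end.\<close>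

lemma rising_word_intervals_disjoint:
  assumes F: "union_closed F" "f \<in> F" "g \<in> F"
    and "g \<subseteq> rising_word F w f" "f \<subseteq> rising_word F w g"
  shows "f = g"
proof -
  have "f \<union> g \<in> F" using F by (auto simp: union_closed_def)
  moreover have "f \<union> g \<subseteq> rising_word F w f" "f \<union> g \<subseteq> rising_word F w g"
    using assms(4,5) by (simp_all add: subset_rising_word)
  ultimately have "f \<union> g = f" "f \<union> g = g"
    using only_member_between_rising_word[OF F(1)] F(2,3) by simp_all
  then show ?thesis by auto
qed

text \<open>Lets the restriction to \<open>F[S]\<close> be tested on images. If
  \<open>z \<in> S\<close> lies below the image of \<open>f\<close>, then
  \<open>f \<union> z\<close> is a member inside the interval of \<open>f\<close>, so it equals
  \<open>f\<close> and \<open>z \<subseteq> f\<close>.\<close>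

lemma rising_word_in_up_set_iff:
  assumes F: "union_closed F" "F \<subseteq> Pow (set w)" "f \<in> F" and S: "S \<subseteq> F"
  shows "rising_word F w f \<in> up_set (set w) S \<longleftrightarrow> f \<in> members_above F S"
proof
  assume "rising_word F w f \<in> up_set (set w) S"
  then obtain z where z: "z \<in> S" "z \<subseteq> rising_word F w f" by (auto simp: up_set_def)
  have "f \<union> z \<in> F" using F S z(1) by (auto simp: union_closed_def)
  moreover have "f \<union> z \<subseteq> rising_word F w f" using z(2) subset_rising_word[of f F w] by auto
  ultimately have "f \<union> z = f"
    using only_member_between_rising_word[OF F(1,3)] by blast
  then show "f \<in> members_above F S" using z(1) F(3) by (auto simp: members_above_def)
next
  assume "f \<in> members_above F S"
  then obtain z where "z \<in> S" "z \<subseteq> f" by (auto simp: members_above_def)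
  moreover have "rising_word F w f \<subseteq> set w"
    using rising_word_subset[of F w f] F(2,3) by blast
  ultimately show "rising_word F w f \<in> up_set (set w) S"
    using subset_rising_word[of f F w] by (auto simp: up_set_def)
qed

lemma sum_power_two_rising_word_le:
  assumes F: "union_closed F" "F \<subseteq> Pow (set w)"
  shows "(\<Sum>f\<in>members_above F S. 2 ^ card (rising_word F w f - f)) \<le> card (up_set (set w) S)"
proof -
  let ?\<phi> = "rising_word F w" and ?A = "members_above F S"
  have fA: "finite ?A"
    using F(2) by (auto simp: members_above_def intro: finite_subset[of _ "Pow (set w)"])
  have AF: "?A \<subseteq> F" by (auto simp: members_above_def)
  have sub: "?\<phi> f \<subseteq> set w" if "f \<in> F" for f
    using rising_word_subset[of F w f] that F(2) by blast
  have fin: "finite (?\<phi> f)" if "f \<in> F" for f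
    using sub[OF that] finite_subset by auto
  have "card {f..?\<phi> f} = 2 ^ card (?\<phi> f - f)" if "f \<in> F" for f
  proof -
    \<comment> \<open>An element of the interval is determined by what it adds to
      \<open>f\<close>.\<close>
    have "bij_betw (\<lambda>d. f \<union> d) (Pow (?\<phi> f - f)) {f..?\<phi> f}"
      using subset_rising_word[of f F w]
      by (intro bij_betw_byWitness[where f' = "\<lambda>h. h - f"]) auto
    then have "card {f..?\<phi> f} = card (Pow (?\<phi> f - f))"
      by (simp add: bij_betw_same_card)
    then show ?thesis using fin[OF that] by (simp add: card_Pow)
  qed
  then have "(\<Sum>f\<in>?A. 2 ^ card (?\<phi> f - f)) = (\<Sum>f\<in>?A. card {f..?\<phi> f})"
    using AF by (intro sum.cong) auto
  also have "\<dots> = card (\<Union>f\<in>?A. {f..?\<phi> f})"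
  proof (rule card_UN_disjoint[symmetric, OF fA])
    show "\<forall>f\<in>?A. finite {f..?\<phi> f}"
    proof
      fix f assume "f \<in> ?A"
      then have "finite (Pow (?\<phi> f))" using fin AF by auto
      then show "finite {f..?\<phi> f}" by (rule rev_finite_subset) auto
    qed
    show "\<forall>f\<in>?A. \<forall>g\<in>?A. f \<noteq> g \<longrightarrow> {f..?\<phi> f} \<inter> {g..?\<phi> g} = {}"
    proof (intro ballI impI)
      fix f g assume fg: "f \<in> ?A" "g \<in> ?A" "f \<noteq> g"
      then have "\<not> (g \<subseteq> ?\<phi> f \<and> f \<subseteq> ?\<phi> g)"
        using rising_word_intervals_disjoint[OF F(1)] AF by blast
      then show "{f..?\<phi> f} \<inter> {g..?\<phi> g} = {}"
        unfolding disjoint_iff atLeastAtMost_iff by (meson order_trans)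
    qed
  qed
  also have "\<dots> \<le> card (up_set (set w) S)"
  proof (rule card_mono)
    show "finite (up_set (set w) S)"
      by (rule finite_subset[of _ "Pow (set w)"]) (auto simp: up_set_def)
    show "(\<Union>f\<in>?A. {f..?\<phi> f}) \<subseteq> up_set (set w) S"
    proof
      fix h assume "h \<in> (\<Union>f\<in>?A. {f..?\<phi> f})"
      then obtain f where f: "f \<in> ?A" "f \<subseteq> h" "h \<subseteq> ?\<phi> f" by auto
      then obtain z where "z \<in> S" "z \<subseteq> f" by (auto simp: members_above_def)
      then show "h \<in> up_set (set w) S"
        using f sub[of f] AF by (auto simp: up_set_def)
    qed
  qed
  finally show ?thesis .
qed

section \<open>Convexity and counting by letters\<close>

lemma sum_exponents_le_log:
  fixes d :: "'b \<Rightarrow> nat"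
  assumes A: "finite A" "A \<noteq> {}" and le: "(\<Sum>x\<in>A. 2 ^ d x) \<le> (M::nat)"
  shows "(\<Sum>x\<in>A. real (d x)) \<le> real (card A) * log 2 (real M / real (card A))"
proof -
  define N where "N = real (card A)"
  define c where "c = real M / N"
  have N: "N > 0" using A by (simp add: N_def card_gt_0_iff)
  have "(\<Sum>x\<in>A. 2 ^ d x) > (0::nat)" using A by (intro sum_pos) auto
  then have "M > 0" using le by linarith
  then have c: "c > 0" using N by (simp add: c_def)
  \<comment> \<open>Jensen's inequality by a supporting line: this is the tangent to the function
    2^t at \<open>t = log 2 c\<close>. As \<open>c = M / N\<close>, its constant terms sum to
    \<open>c * N = M\<close>, which cancels against the given bound and leaves only the linear
    part.\<close>
  have tangent: "c * (1 + ln 2 * (real (d x) - log 2 c)) \<le> 2 ^ d x" for x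
  proof -
    have "1 + ln 2 * (real (d x) - log 2 c) \<le> exp (ln 2 * (real (d x) - log 2 c))"
      by (rule exp_ge_add_one_self)
    also have "\<dots> = 2 powr (real (d x) - log 2 c)" by (simp add: powr_def mult.commute)
    also have "\<dots> = 2 ^ d x / c" using c by (simp add: powr_diff powr_realpow)
    finally show ?thesis using c by (simp add: field_simps)
  qed
  have "c * (N + ln 2 * ((\<Sum>x\<in>A. real (d x)) - N * log 2 c))
      = (\<Sum>x\<in>A. c * (1 + ln 2 * (real (d x) - log 2 c)))"
    by (simp add: N_def sum_distrib_left[symmetric] sum.distrib sum_subtractf)
  also have "\<dots> \<le> (\<Sum>x\<in>A. 2 ^ d x)" by (intro sum_mono tangent)
  also have "\<dots> \<le> real M" using of_nat_mono[OF le, where 'a = real] by simp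
  also have "\<dots> = c * N" using N by (simp add: c_def)
  finally have "ln 2 * ((\<Sum>x\<in>A. real (d x)) - N * log 2 c) \<le> 0" using c by simp
  then have "(\<Sum>x\<in>A. real (d x)) - N * log 2 c \<le> 0" by (simp add: mult_le_0_iff)
  then show ?thesis by (simp add: N_def c_def)
qed

text \<open>Double counting of the pairs \<open>(x, a)\<close> with \<open>a \<in> g x\<close>. The
  map \<open>g\<close> is kept general so as to cover both the sets themselves and their images
  under rising.\<close>

lemma sum_card_eq_sum_degrees:
  assumes "finite A" "finite X" "\<And>x. x \<in> A \<Longrightarrow> g x \<subseteq> X"
  shows "(\<Sum>x\<in>A. card (g x)) = (\<Sum>a\<in>X. card {x \<in> A. a \<in> g x})"
proof -
  have "(\<Sum>x\<in>A. card (g x)) = (\<Sum>x\<in>A. \<Sum>a\<in>X. if a \<in> g x then 1 else 0)"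
  proof (rule sum.cong[OF refl])
    fix x assume "x \<in> A"
    then have "X \<inter> {a. a \<in> g x} = g x" using assms(3) by auto
    then show "card (g x) = (\<Sum>a\<in>X. if a \<in> g x then 1 else 0)"
      using assms(2) by (simp add: sum.If_cases)
  qed
  also have "\<dots> = (\<Sum>a\<in>X. \<Sum>x\<in>A. if a \<in> g x then 1 else 0)" by (rule sum.swap)
  also have "\<dots> = (\<Sum>a\<in>X. card {x \<in> A. a \<in> g x})"
    using assms(1) by (simp add: sum.If_cases Int_def)
  finally show ?thesis .
qed

text \<open>Both families on the left are realised inside the image of the right-hand one: the first
  by inserting \<open>a\<close> into the image of \<open>f\<close>, the second directly. They do not
  overlap, as removing \<open>a\<close> from a set of the first kind gives back an element of the
  image, which purity forbids.\<close>

lemma card_pure_elements_le: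
  assumes F: "union_closed F" "F \<subseteq> Pow (set w)" and S: "S \<subseteq> F" and a: "a \<in> set w"
  shows "card {f \<in> members_above F S. a \<notin> rising_word F w f}
      + card (pure_elements F w a \<inter> up_set (set w) S)
    \<le> card {f \<in> members_above F S. a \<in> f}"
proof -
  let ?\<phi> = "rising_word F w" and ?A = "members_above F S"
  let ?B = "{f \<in> ?A. a \<notin> ?\<phi> f}" and ?P = "pure_elements F w a \<inter> up_set (set w) S"
  let ?C = "{f \<in> ?A. a \<in> f}"
  have fA: "finite ?A"
    using F(2) by (auto simp: members_above_def intro: finite_subset[of _ "Pow (set w)"])
  have AF: "?A \<subseteq> F" by (auto simp: members_above_def)
  have P: "?P \<subseteq> ?\<phi> ` ?C"
  proof
    fix \<eta> assume "\<eta> \<in> ?P"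
    then obtain f where "f \<in> F" "a \<in> f" "\<eta> = ?\<phi> f" "?\<phi> f \<in> up_set (set w) S"
      by (auto simp: pure_elements_def members_with_def)
    then show "\<eta> \<in> ?\<phi> ` ?C" using rising_word_in_up_set_iff[OF F _ S, of f] by simp
  qed
  have finP: "finite ?P" by (rule finite_subset[OF P]) (simp add: fA)
  have B: "insert a (?\<phi> f) \<in> ?\<phi> ` ?C" if f: "f \<in> ?B" for f
  proof -
    have fF: "f \<in> F" using f AF by auto
    obtain g where g: "g \<in> F" "insert a (?\<phi> f) = ?\<phi> g"
      using rising_word_image_insert_closed[OF a, of "?\<phi> f" F] fF by auto
    have "?\<phi> f \<in> up_set (set w) S"
      using rising_word_in_up_set_iff[OF F fF S] f by auto
    then have "?\<phi> g \<in> up_set (set w) S"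
      unfolding g(2)[symmetric] using a by (auto simp: up_set_def)
    then have gA: "g \<in> ?A" using rising_word_in_up_set_iff[OF F g(1) S] by simp
    \<comment> \<open>If \<open>g\<close> lacked \<open>a\<close>, the intervals of \<open>f\<close>
      and \<open>g\<close> would meet, forcing \<open>f = g\<close>, although \<open>a\<close> lies
      in the image of \<open>g\<close> and not in that of \<open>f\<close>.\<close>
    have "a \<in> g"
    proof (rule ccontr)
      assume "a \<notin> g"
      then have "g \<subseteq> ?\<phi> f" using subset_rising_word[of g F w] g(2) by auto
      moreover have "f \<subseteq> ?\<phi> g" using subset_rising_word[of f F w] g(2) by auto
      ultimately have "f = g" using rising_word_intervals_disjoint[OF F(1) fF g(1)] by blast
      then show False using g(2) f by auto
    qed
    then show ?thesis unfolding g(2) using gA by simp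
  qed
  have "insert a (?\<phi> f) \<notin> ?P" if "f \<in> ?B" for f
    using that AF by (auto simp: pure_elements_def)
  then have disj: "((\<lambda>f. insert a (?\<phi> f)) ` ?B) \<inter> ?P = {}" by blast
  have "inj_on (\<lambda>f. insert a (?\<phi> f)) ?B"
  proof (rule inj_onI)
    fix f g assume fg: "f \<in> ?B" "g \<in> ?B" "insert a (?\<phi> f) = insert a (?\<phi> g)"
    then have "?\<phi> f = ?\<phi> g" using insert_ident[of a "?\<phi> f" "?\<phi> g"] by simp
    then show "f = g" using inj_onD[OF inj_on_rising_word] fg AF by blast
  qed
  then have "card ?B + card ?P = card (((\<lambda>f. insert a (?\<phi> f)) ` ?B) \<union> ?P)"
    using fA finP disj by (simp add: card_Un_disjoint card_image)
  also have "\<dots> \<le> card (?\<phi> ` ?C)"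
    using fA by (intro card_mono Un_least image_subsetI B P) auto
  also have "\<dots> \<le> card ?C" using fA by (intro card_image_le) auto
  finally show ?thesis .
qed

section \<open>Upward-closed families, for the equality case\<close>

lemma upward_closed_insert:
  assumes "upward_closed X F" "F \<subseteq> Pow X" "a \<in> X" "f \<in> F"
  shows "insert a f \<in> F"
proof -
  have "insert a f \<subseteq> X" using assms by blast
  then show ?thesis using assms(1,4) unfolding upward_closed_def by (meson subset_insertI)
qed

text \<open>Every target \<open>insert a f\<close> is already occupied, so no step moves
  anything.\<close>

lemma rising_word_upward_closed:
  assumes F: "upward_closed (set w) F" "F \<subseteq> Pow (set w)" and f: "f \<in> F"
  shows "rising_word F w f = f"
proof -
  have "j \<le> length w \<Longrightarrow> \<forall>f\<in>F. rising_upto F w j f = f" for j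
  proof (induction j)
    case (Suc j)
    then have id: "\<forall>f\<in>F. rising_upto F w j f = f" by simp
    then have "rising_upto F w j ` F = F" by (simp cong: image_cong)
    moreover have "insert (w ! j) f \<in> F" if "f \<in> F" for f
      using upward_closed_insert[OF F _ that] Suc.prems by simp
    ultimately show ?case using id by (auto simp: rising_def)
  qed simp
  then show ?thesis using f by (simp add: rising_word_def)
qed

text \<open>Inserting \<open>a\<close> matches the members without \<open>a\<close> to those members
  with \<open>a\<close> that stay in \<open>F\<close> when \<open>a\<close> is removed. As rising is
  the identity here, the unmatched members with \<open>a\<close> are exactly the pure
  elements.\<close>

lemma card_pure_elements_upward_closed:
  assumes F: "upward_closed (set w) F" "F \<subseteq> Pow (set w)" and a: "a \<in> set w"
  shows "card {f \<in> F. a \<notin> f} + card (pure_elements F w a) = card {f \<in> F. a \<in> f}"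
proof -
  have fF: "finite F" using F(2) finite_subset by auto
  have id: "rising_word F w f = f" if "f \<in> F" for f
    using rising_word_upward_closed[OF F that] .
  have "rising_word F w ` H = id ` H" if "H \<subseteq> F" for H
    using that id by (intro image_cong) auto
  then have "rising_word F w ` F = F" "rising_word F w ` members_with F a = members_with F a"
    by (simp_all add: members_with_def)
  then have P: "pure_elements F w a = {f \<in> F. a \<in> f \<and> f - {a} \<notin> F}"
    by (auto simp: pure_elements_def members_with_def)
  have "insert a f \<in> F" if "f \<in> F" for f
    using upward_closed_insert[OF F a that] .
  then have "bij_betw (insert a) {f \<in> F. a \<notin> f} {f \<in> F. a \<in> f \<and> f - {a} \<in> F}"
    by (intro bij_betw_byWitness[where f' = "\<lambda>f. f - {a}"]) (auto simp: insert_absorb)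
  then have "card {f \<in> F. a \<notin> f} = card {f \<in> F. a \<in> f \<and> f - {a} \<in> F}"
    by (rule bij_betw_same_card)
  then have "card {f \<in> F. a \<notin> f} + card (pure_elements F w a)
      = card ({f \<in> F. a \<in> f \<and> f - {a} \<in> F} \<union> pure_elements F w a)"
    using fF P by (subst card_Un_disjoint) auto
  also have "{f \<in> F. a \<in> f \<and> f - {a} \<in> F} \<union> pure_elements F w a = {f \<in> F. a \<in> f}"
    using P by auto
  finally show ?thesis .
qed

lemma members_above_min_members:
  assumes "finite F" "F \<subseteq> Pow X"
  shows "members_above F (min_members F) = F"
proof -
  have "\<exists>z\<in>min_members F. z \<subseteq> f" if "f \<in> F" for f
    using finite_has_minimal2[OF assms(1) that] by (auto simp: min_members_def)
  then show ?thesis by (auto simp: members_above_def)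
qed

lemma up_set_eq_members_above:
  assumes "upward_closed X F" "F \<subseteq> Pow X" "S \<subseteq> F"
  shows "up_set X S = members_above F S"
proof
  show "up_set X S \<subseteq> members_above F S"
  proof
    fix g assume "g \<in> up_set X S"
    then obtain z where "z \<in> S" "z \<subseteq> g" "g \<subseteq> X" by (auto simp: up_set_def)
    moreover from this have "g \<in> F" using assms(1,3) unfolding upward_closed_def by blast
    ultimately show "g \<in> members_above F S" by (auto simp: members_above_def)
  qed
  show "members_above F S \<subseteq> up_set X S"
    using assms(2) by (auto simp: up_set_def members_above_def)
qed

section \<open>Combination of the estimates\<close>

theorem theorem5p12:
  fixes X :: "'a set" and F S :: "'a set set" and w :: "'a list" and n :: nat
  assumes "distinct w" and "length w = n" and "X = set w"
    and "F \<subseteq> Pow X" and "union_closed F" and "\<Union>F = X"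
    and "S \<subseteq> F" and "antichain S"
  shows "(\<Sum>f\<in>members_above F S. real (card f)) / real (card (members_above F S))
      \<ge> real n / 2
        + (\<Sum>a\<in>X. real (card (pure_elements F w a \<inter> up_set X S)))
            / (2 * real (card (members_above F S)))
        - 1 / 2 * log 2 (real (card (up_set X S)) / real (card (members_above F S)))
    \<and> (upward_closed X F \<and> S = min_members F \<longrightarrow>
        (\<Sum>f\<in>members_above F S. real (card f)) / real (card (members_above F S))
      = real n / 2
        + (\<Sum>a\<in>X. real (card (pure_elements F w a \<inter> up_set X S)))
            / (2 * real (card (members_above F S)))
        - 1 / 2 * log 2 (real (card (up_set X S)) / real (card (members_above F S))))"
proof -
  let ?\<phi> = "rising_word F w" and ?A = "members_above F S"
  let ?P = "\<lambda>a. pure_elements F w a \<inter> up_set X S"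
  define N where "N = card ?A"
  have FX: "F \<subseteq> Pow (set w)" and fX: "finite X" and finF: "finite F"
    using assms finite_subset[of F "Pow X"] by auto
  have AF: "?A \<subseteq> F" by (auto simp: members_above_def)
  then have fA: "finite ?A" using finF finite_subset by blast
  have A0: "?A \<noteq> {}"
    using assms(7,8) by (auto simp: members_above_def antichain_def)
  have N: "N > 0" using fA A0 by (simp add: N_def card_gt_0_iff)
  have cX: "card X = n" using assms(1-3) distinct_card by auto
  have split: "card {f \<in> ?A. a \<notin> g f} + card {f \<in> ?A. a \<in> g f} = N" for a and g :: "'a set \<Rightarrow> 'a set"
    unfolding N_def using fA by (subst card_Un_disjoint[symmetric]) (auto intro!: arg_cong[where f = card])
  have deg: "(\<Sum>f\<in>?A. card (g f)) = (\<Sum>a\<in>X. card {f \<in> ?A. a \<in> g f})"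
    if "\<And>f. f \<in> ?A \<Longrightarrow> g f \<subseteq> X" for g :: "'a set \<Rightarrow> 'a set"
    using sum_card_eq_sum_degrees[OF fA fX that] .
  have fsub: "f \<subseteq> X" if "f \<in> ?A" for f using that AF assms(4) by auto
  have \<phi>sub: "?\<phi> f \<subseteq> X" if "f \<in> ?A" for f
    using rising_word_subset[of F w f] fsub[OF that] assms(3) by auto
  have "n * N + (\<Sum>a\<in>X. card (?P a)) = (\<Sum>a\<in>X. N + card (?P a))"
    by (simp add: sum.distrib cX)
  also have "\<dots> \<le> (\<Sum>a\<in>X. card {f \<in> ?A. a \<in> f} + card {f \<in> ?A. a \<in> ?\<phi> f})"
  proof (rule sum_mono)
    fix a assume "a \<in> X"
    \<comment> \<open>Adding the number of \<open>f\<close> with \<open>a \<in> ?\<phi> f\<close> to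
      both sides of \<open>card_pure_elements_le\<close> completes the count of those with
      \<open>a \<notin> ?\<phi> f\<close> to \<open>N\<close>.\<close>
    then show "N + card (?P a) \<le> card {f \<in> ?A. a \<in> f} + card {f \<in> ?A. a \<in> ?\<phi> f}"
      using card_pure_elements_le[OF assms(5) FX assms(7), of a] split[of a ?\<phi>] assms(3) by auto
  qed
  also have "\<dots> = (\<Sum>f\<in>?A. card f) + (\<Sum>f\<in>?A. card (?\<phi> f))"
    using deg[of "\<lambda>f. f"] deg[of ?\<phi>] fsub \<phi>sub by (simp add: sum.distrib)
  also have "(\<Sum>f\<in>?A. card (?\<phi> f)) = (\<Sum>f\<in>?A. card f + card (?\<phi> f - f))"
  proof (rule sum.cong[OF refl])
    fix f assume f: "f \<in> ?A"
    have "finite (?\<phi> f)" using \<phi>sub[OF f] fX finite_subset by blast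
    then show "card (?\<phi> f) = card f + card (?\<phi> f - f)"
      using subset_rising_word[of f F w]
      by (metis card_Diff_subset card_mono finite_subset le_add_diff_inverse)
  qed
  finally have "n * N + (\<Sum>a\<in>X. card (?P a))
      \<le> 2 * (\<Sum>f\<in>?A. card f) + (\<Sum>f\<in>?A. card (?\<phi> f - f))"
    by (simp add: sum.distrib)
  then have "real (n * N + (\<Sum>a\<in>X. card (?P a)))
      \<le> real (2 * (\<Sum>f\<in>?A. card f) + (\<Sum>f\<in>?A. card (?\<phi> f - f)))"
    by (rule of_nat_mono)
  moreover have "(\<Sum>f\<in>?A. real (card (?\<phi> f - f))) \<le> N * log 2 (card (up_set X S) / N)"
    unfolding N_def
    using sum_exponents_le_log[OF fA A0 sum_power_two_rising_word_le[OF assms(5) FX]] assms(3)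
    by simp
  ultimately have "n * N + (\<Sum>a\<in>X. real (card (?P a)))
      \<le> 2 * (\<Sum>f\<in>?A. real (card f)) + N * log 2 (card (up_set X S) / N)"
    by simp
  \<comment> \<open>Division by \<open>2 * N\<close> turns the sum of the \<open>card f\<close> into
    their average and leaves the factor 1/2 on the logarithm.\<close>
  from divide_right_mono[OF this, of "2 * real N"] have "(\<Sum>f\<in>?A. real (card f)) / N
      \<ge> n / 2 + (\<Sum>a\<in>X. real (card (?P a))) / (2 * real N) - 1 / 2 * log 2 (card (up_set X S) / N)"
    using N by (simp add: add_divide_distrib)
  moreover have "(\<Sum>f\<in>?A. real (card f)) / N
      = n / 2 + (\<Sum>a\<in>X. real (card (?P a))) / (2 * real N) - 1 / 2 * log 2 (card (up_set X S) / N)"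
    if up: "upward_closed X F" and min: "S = min_members F"
  proof -
    have A: "?A = F" using members_above_min_members[OF finF assms(4)] min by simp
    have U: "up_set X S = F" using up_set_eq_members_above[OF up assms(4,7)] A by simp
    have up': "upward_closed (set w) F" using up assms(3) by simp
    \<comment> \<open>Pure elements are images of members, hence members, and the up-set is now all
      of \<open>F\<close>.\<close>
    have "?P a = pure_elements F w a" if "a \<in> X" for a
    proof -
      have "?\<phi> f \<in> F" if "f \<in> F" for f
        using rising_word_upward_closed[OF up' FX that] that by simp
      then show ?thesis unfolding U by (auto simp: pure_elements_def members_with_def)
    qed
    then have "card {f \<in> F. a \<notin> f} + card (?P a) = card {f \<in> F. a \<in> f}" if "a \<in> X" for a
      using card_pure_elements_upward_closed[OF up' FX] that assms(3) by simp
    then have "N + card (?P a) = 2 * card {f \<in> F. a \<in> f}" if "a \<in> X" for a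
      using split[of a "\<lambda>f. f"] that unfolding A by fastforce
    then have "(\<Sum>a\<in>X. N + card (?P a)) = (\<Sum>a\<in>X. 2 * card {f \<in> F. a \<in> f})"
      by (intro sum.cong) auto
    then have "n * N + (\<Sum>a\<in>X. card (?P a)) = 2 * (\<Sum>f\<in>F. card f)"
      using deg[of "\<lambda>f. f"] fsub unfolding A by (simp add: sum.distrib cX sum_distrib_left)
    then have "real (n * N + (\<Sum>a\<in>X. card (?P a))) = real (2 * (\<Sum>f\<in>F. card f))" by simp
    \<comment> \<open>The argument of the logarithm is thus 1, and its term vanishes.\<close>
    moreover have "card (up_set X S) = N" unfolding U N_def A ..
    ultimately show ?thesis using N unfolding A by (simp add: field_simps)
  qed
  ultimately show ?thesis unfolding N_def by blast
qed

end
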